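(* Let $k \geq 1$ be an integer. For any two graphs $G_1, G_2$: (i) $\alpha_k(G_1 \square G_2) \geq \alpha_k(G_1) \cdot \alpha_k(G_2)$; (ii) $\alpha_k(G_1 \square G_2) \leq \min\left(\alpha_k(G_1) \cdot |V(G_2)|,\ \alpha_k(G_2) \cdot |V(G_1)|\right)$.
   Context: Graphs are finite, simple and undirected. For a graph $G$, $\delta_G(u,v)$ is the length of a shortest path between vertices $u$ and $v$ in $G$ (equal to $\infty$ if there is none). A set $S \subseteq V(G)$ is $k$-independent if $\delta_G(u,v) > k$ for all distinct $u,v \in S$; $\alpha_k(G)$ denotes the maximum size of a $k$-independent set in $G$. The Cartesian product $G_1 \square G_2$ has vertex set $V(G_1)\times V(G_2)$, and $(u_1,u_2),(v_1,v_2)$ are adjacent if and only if ($u_1=v_1$ and $(u_2,v_2)\in E(G_2)$) or ($u_2=v_2$ and $(u_1,v_1)\in E(G_1)$). *)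

theory Defs
  imports "Graph_Theory.Graph_Theory"
begin

text \<open>
  Finite simple undirected graphs are the library's \<^locale>\<open>pair_graph\<close>s: finite, loop-free,
  without parallel arcs, and symmetric, so that an undirected edge is a pair of opposite arcs.
  Vertices are an explicit carrier set; the graph without vertices is not excluded.
\<close>

text \<open>The library's shortest-path distance, with every arc of weight 1.\<close>

definition graph_dist :: "'a pair_pre_digraph \<Rightarrow> 'a \<Rightarrow> 'a \<Rightarrow> ereal" where
  "graph_dist G u v = wf_digraph.\<mu> (with_proj G) (\<lambda>_. 1) u v"

text \<open>
  The library takes the infimum over all walks; restricting it to paths changes nothing.
  The empty infimum is \<open>\<infinity>\<close>.
\<close>

lemma graph_dist_eq_path_length:
  assumes "pair_graph G"
  shows "graph_dist G u v =
    (INF p \<in> {p. pre_digraph.apath (with_proj G) u p v}. ereal (real (length p)))"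
proof -
  have "wf_digraph (with_proj G)"
  proof -
    interpret pair_graph G by fact
    show ?thesis by (rule wf_digraph)
  qed
  then interpret D: wf_digraph "with_proj G" .
  have cost: "D.awalk_cost (\<lambda>_. 1) p = real (length p)" for p :: "('a \<times> 'a) list"
    by (induct p) (auto simp: D.awalk_cost_def)
  have "\<exists>q \<in> {q. D.apath u q v}. ereal (real (length q)) \<le> ereal (real (length p))"
    if "D.awalk u p v" for p
    using D.awalk_to_path_no_neg_cyc_cost[OF that, of "\<lambda>_. 1"] D.apath_awalk_to_apath[OF that]
    by (auto simp: cost intro!: exI[of _ "D.awalk_to_apath p"])
  then show ?thesis
    unfolding graph_dist_def D.\<mu>_def cost
    by (intro antisym INF_mono) (auto dest: D.awalkI_apath)
qed

definition k_independent :: "nat \<Rightarrow> 'a pair_pre_digraph \<Rightarrow> 'a set \<Rightarrow> bool" where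
  "k_independent k G S \<longleftrightarrow>
    S \<subseteq> pverts G \<and> (\<forall>u \<in> S. \<forall>v \<in> S. u \<noteq> v \<longrightarrow> graph_dist G u v > ereal (real k))"

definition k_independence_number :: "nat \<Rightarrow> 'a pair_pre_digraph \<Rightarrow> nat" where
  "k_independence_number k G = Max {card S | S. k_independent k G S}"

definition cartesian_product ::
  "'a pair_pre_digraph \<Rightarrow> 'b pair_pre_digraph \<Rightarrow> ('a \<times> 'b) pair_pre_digraph" (infixl "\<box>" 70) where
  "G\<^sub>1 \<box> G\<^sub>2 =
    \<lparr> pverts = pverts G\<^sub>1 \<times> pverts G\<^sub>2,
      parcs = {((u\<^sub>1, u\<^sub>2), (v\<^sub>1, v\<^sub>2)) | u\<^sub>1 u\<^sub>2 v\<^sub>1 v\<^sub>2.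
        (u\<^sub>1, u\<^sub>2) \<in> pverts G\<^sub>1 \<times> pverts G\<^sub>2 \<and> (v\<^sub>1, v\<^sub>2) \<in> pverts G\<^sub>1 \<times> pverts G\<^sub>2 \<and>
        ((u\<^sub>1 = v\<^sub>1 \<and> (u\<^sub>2, v\<^sub>2) \<in> parcs G\<^sub>2) \<or> (u\<^sub>2 = v\<^sub>2 \<and> (u\<^sub>1, v\<^sub>1) \<in> parcs G\<^sub>1))} \<rparr>"

lemma pair_graph_cartesian_product:
  assumes "pair_graph G\<^sub>1" "pair_graph G\<^sub>2"
  shows "pair_graph (G\<^sub>1 \<box> G\<^sub>2)"
proof -
  interpret G1: pair_graph G\<^sub>1 by fact
  interpret G2: pair_graph G\<^sub>2 by fact
  let ?V = "pverts G\<^sub>1 \<times> pverts G\<^sub>2"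
  have fin: "finite ?V"
    using G1.pair_finite_verts G2.pair_finite_verts by simp
  have sub: "parcs (G\<^sub>1 \<box> G\<^sub>2) \<subseteq> ?V \<times> ?V"
    by (auto simp: cartesian_product_def)
  have finarcs: "finite (parcs (G\<^sub>1 \<box> G\<^sub>2))"
    using finite_subset[OF sub] fin by blast
  show ?thesis
  proof
    show "symmetric (with_proj (G\<^sub>1 \<box> G\<^sub>2))"
      using G1.pair_sym_arcs G2.pair_sym_arcs
      by (auto simp: symmetric_def cartesian_product_def intro!: symI dest: symD)
  qed (use fin finarcs G1.pair_no_loops G2.pair_no_loops in
      \<open>auto simp: cartesian_product_def dest: G1.pair_no_loops G2.pair_no_loops\<close>)
qed

end

theory Submission
  imports Defs
begin

text \<open>
  A map that sends every edge to an edge or to a single vertex does not increase distances.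
  Both coordinate projections of \<open>G\<^sub>1 \<box> G\<^sub>2\<close> are such maps, so products of
  \<open>k\<close>-independent sets are \<open>k\<close>-independent. The embeddings of the factors as fibres are such
  maps as well, so a \<open>k\<close>-independent set of the product meets every fibre in (a copy of) a
  \<open>k\<close>-independent set of the factor.
\<close>

definition weak_hom :: "('a \<Rightarrow> 'b) \<Rightarrow> 'a pair_pre_digraph \<Rightarrow> 'b pair_pre_digraph \<Rightarrow> bool" where
  "weak_hom f G H \<longleftrightarrow> f ` pverts G \<subseteq> pverts H \<and>
    (\<forall>(u, v) \<in> parcs G. f u = f v \<or> (f u, f v) \<in> parcs H)"

text \<open>Map the walk arc by arc and drop every arc whose ends have the same image. The dropped
  arcs are why the lengths are related by \<le> and not by equality.\<close>

lemma weak_hom_awalk: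
  assumes "pair_graph G" "pair_graph H" "weak_hom f G H"
    and "pre_digraph.awalk (with_proj G) u p v"
  shows "\<exists>q. pre_digraph.awalk (with_proj H) (f u) q (f v) \<and> length q \<le> length p"
proof -
  interpret G: pair_graph G by fact
  interpret H: pair_graph H by fact
  show ?thesis
    using assms(4)
  proof (induction p arbitrary: u)
    case Nil
    then show ?case
      using assms(3) by (intro exI[of _ "[]"]) (auto simp: G.awalk_Nil_iff H.awalk_Nil_iff weak_hom_def)
  next
    case (Cons e p)
    then have e: "e \<in> parcs G" "fst e = u" and "G.awalk (snd e) p v"
      by (auto simp: G.awalk_Cons_iff)
    from Cons.IH[OF this(3)] obtain q
      where q: "H.awalk (f (snd e)) q (f v)" "length q \<le> length p" by blast
    from e assms(3) have "f u = f (snd e) \<or> (f u, f (snd e)) \<in> parcs H"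
      by (auto simp: weak_hom_def)
    then show ?case
    proof
      assume "f u = f (snd e)"
      with q show ?thesis by (intro exI[of _ q]) auto
    next
      assume "(f u, f (snd e)) \<in> parcs H"
      with q show ?thesis
        by (intro exI[of _ "(f u, f (snd e)) # q"]) (auto simp: H.awalk_Cons_iff)
    qed
  qed
qed

text \<open>Each walk in \<open>G\<close> yields a walk in \<open>H\<close> of no larger cost, and
  the infima compare accordingly. As the distance ranges over all walks, it does not matter that the
  image of a path may repeat vertices. If no walk joins \<open>u\<close> and \<open>v\<close>, the
  right-hand side is \<infinity>.\<close>

lemma weak_hom_graph_dist_le:
  assumes "pair_graph G" "pair_graph H" "weak_hom f G H"
  shows "graph_dist H (f u) (f v) \<le> graph_dist G u v"
proof -
  interpret G: pair_graph G by fact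
  interpret H: pair_graph H by fact
  have "G.awalk_cost (\<lambda>_. 1) p = real (length p)" for p
    by (induct p) (auto simp: G.awalk_cost_def)
  moreover have "H.awalk_cost (\<lambda>_. 1) q = real (length q)" for q
    by (induct q) (auto simp: H.awalk_cost_def)
  ultimately show ?thesis
    unfolding graph_dist_def G.\<mu>_def H.\<mu>_def
    by (intro INF_mono) (use weak_hom_awalk[OF assms] in fastforce)
qed

lemma finite_k_independent_cards:
  assumes "pair_graph G"
  shows "finite {card S | S. k_independent k G S}"
proof -
  interpret pair_graph G by fact
  have "{card S | S. k_independent k G S} \<subseteq> card ` Pow (pverts G)"
    by (auto simp: k_independent_def)
  then show ?thesis
    by (rule finite_subset) simp
qed

lemma card_le_k_independence_number:
  assumes "pair_graph G" "k_independent k G S"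
  shows "card S \<le> k_independence_number k G"
  unfolding k_independence_number_def
  using assms by (intro Max_ge finite_k_independent_cards) auto

lemma k_independence_number_attained:
  assumes "pair_graph G"
  obtains S where "k_independent k G S" "card S = k_independence_number k G"
proof -
  \<comment> \<open>The empty set is a candidate in every graph, even one without vertices, so the
    maximum is taken over a nonempty set.\<close>
  have "k_independent k G {}"
    by (simp add: k_independent_def)
  then have "k_independence_number k G \<in> {card S | S. k_independent k G S}"
    unfolding k_independence_number_def
    using assms by (intro Max_in finite_k_independent_cards) auto
  with that show ?thesis
    by auto
qed

text \<open>Serves both upper bounds: if images of \<open>G\<close> under the maps
  \<open>f w\<close> cover \<open>H\<close>, a largest \<open>k\<close>-independent set of
  \<open>H\<close> has at most \<open>k_independence_number k G\<close> points in each of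
  them.\<close>

lemma k_independence_number_le_mult_card_cover:
  assumes "pair_graph G" "pair_graph H" "finite W"
    and hom: "\<And>w. w \<in> W \<Longrightarrow> weak_hom (f w) G H"
    and cover: "pverts H \<subseteq> (\<Union>w\<in>W. f w ` pverts G)"
  shows "k_independence_number k H \<le> k_independence_number k G * card W"
proof -
  interpret H: pair_graph H by fact
  obtain S where S: "k_independent k H S" and card_S: "card S = k_independence_number k H"
    using k_independence_number_attained[OF assms(2)] .
  have SH: "S \<subseteq> pverts H"
    using S by (simp add: k_independent_def)
  have fibre: "card (S \<inter> f w ` pverts G) \<le> k_independence_number k G" if "w \<in> W" for w
  proof -
    \<comment> \<open>\<open>T\<close> picks one preimage of each point of \<open>S\<close> in the
      image of \<open>f w\<close>. It has as many elements as that part of \<open>S\<close>, whether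
      or not \<open>f w\<close> is injective on all of \<open>G\<close>.\<close>
    obtain T where T: "T \<subseteq> pverts G" "inj_on (f w) T" "S \<inter> f w ` pverts G = f w ` T"
      using subset_image_inj[of "S \<inter> f w ` pverts G" "f w" "pverts G"] by auto
    have "ereal (real k) < graph_dist G u v" if "u \<in> T" "v \<in> T" "u \<noteq> v" for u v
    proof -
      have "f w u \<in> S" "f w v \<in> S" "f w u \<noteq> f w v"
        using T that by (auto dest: inj_onD)
      then have "ereal (real k) < graph_dist H (f w u) (f w v)"
        using S by (simp add: k_independent_def)
      also have "\<dots> \<le> graph_dist G u v"
        using weak_hom_graph_dist_le[OF assms(1,2) hom[OF \<open>w \<in> W\<close>]] .
      finally show ?thesis .
    qed
    with T(1) have "k_independent k G T"
      by (simp add: k_independent_def)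
    with T show ?thesis
      using card_le_k_independence_number[OF assms(1)] by (simp add: card_image)
  qed
  have "S = (\<Union>w\<in>W. S \<inter> f w ` pverts G)"
    using SH cover by auto
  \<comment> \<open>A union bound suffices, so the images may overlap.\<close>
  then have "card S \<le> (\<Sum>w\<in>W. card (S \<inter> f w ` pverts G))"
    using card_UN_le[OF assms(3), of "\<lambda>w. S \<inter> f w ` pverts G"] by simp
  also have "\<dots> \<le> k_independence_number k G * card W"
    using sum_bounded_above[of W, OF fibre] by (simp add: mult.commute)
  finally show ?thesis
    by (simp add: card_S)
qed

lemma weak_hom_projections:
  "weak_hom fst (G\<^sub>1 \<box> G\<^sub>2) G\<^sub>1"
  "weak_hom snd (G\<^sub>1 \<box> G\<^sub>2) G\<^sub>2"
  by (auto simp: weak_hom_def cartesian_product_def)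

lemma weak_hom_fibres:
  assumes "pair_graph G\<^sub>1" "pair_graph G\<^sub>2"
  shows "w \<in> pverts G\<^sub>2 \<Longrightarrow> weak_hom (\<lambda>u. (u, w)) G\<^sub>1 (G\<^sub>1 \<box> G\<^sub>2)"
    and "w' \<in> pverts G\<^sub>1 \<Longrightarrow> weak_hom (\<lambda>u. (w', u)) G\<^sub>2 (G\<^sub>1 \<box> G\<^sub>2)"
proof -
  interpret G1: pair_graph G\<^sub>1 by fact
  interpret G2: pair_graph G\<^sub>2 by fact
  show "w \<in> pverts G\<^sub>2 \<Longrightarrow> weak_hom (\<lambda>u. (u, w)) G\<^sub>1 (G\<^sub>1 \<box> G\<^sub>2)"
    and "w' \<in> pverts G\<^sub>1 \<Longrightarrow> weak_hom (\<lambda>u. (w', u)) G\<^sub>2 (G\<^sub>1 \<box> G\<^sub>2)"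
    by (auto simp: weak_hom_def cartesian_product_def
        dest: G1.in_arcsD1 G1.in_arcsD2 G2.in_arcsD1 G2.in_arcsD2)
qed

lemma k_independent_Times:
  assumes "pair_graph G\<^sub>1" "pair_graph G\<^sub>2"
    and S: "k_independent k G\<^sub>1 S" and T: "k_independent k G\<^sub>2 T"
  shows "k_independent k (G\<^sub>1 \<box> G\<^sub>2) (S \<times> T)"
proof -
  note prod = pair_graph_cartesian_product[OF assms(1,2)]
  have "ereal (real k) < graph_dist (G\<^sub>1 \<box> G\<^sub>2) x y"
    if "x \<in> S \<times> T" "y \<in> S \<times> T" "x \<noteq> y" for x y
  \<comment> \<open>Distinct pairs differ in some coordinate. Projecting to that coordinate gives
    two distinct points of \<open>S\<close> or of \<open>T\<close>, and the projection does not
    increase the distance.\<close>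
  proof (cases "fst x = fst y")
    case True
    then have "ereal (real k) < graph_dist G\<^sub>2 (snd x) (snd y)"
      using T that by (auto simp: k_independent_def prod_eq_iff)
    also have "\<dots> \<le> graph_dist (G\<^sub>1 \<box> G\<^sub>2) x y"
      by (rule weak_hom_graph_dist_le[OF prod assms(2) weak_hom_projections(2)])
    finally show ?thesis .
  next
    case False
    then have "ereal (real k) < graph_dist G\<^sub>1 (fst x) (fst y)"
      using S that by (auto simp: k_independent_def)
    also have "\<dots> \<le> graph_dist (G\<^sub>1 \<box> G\<^sub>2) x y"
      by (rule weak_hom_graph_dist_le[OF prod assms(1) weak_hom_projections(1)])
    finally show ?thesis .
  qed
  moreover have "S \<times> T \<subseteq> pverts (G\<^sub>1 \<box> G\<^sub>2)"
    using S T by (auto simp: k_independent_def cartesian_product_def)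
  ultimately show ?thesis
    unfolding k_independent_def by blast
qed

theorem theorem3p3:
  fixes k :: nat
    and G\<^sub>1 :: "'a pair_pre_digraph"
    and G\<^sub>2 :: "'b pair_pre_digraph"
  assumes "k \<ge> 1"
    and "pair_graph G\<^sub>1"
    and "pair_graph G\<^sub>2"
  shows "k_independence_number k (G\<^sub>1 \<box> G\<^sub>2)
           \<ge> k_independence_number k G\<^sub>1 * k_independence_number k G\<^sub>2
       \<and> k_independence_number k (G\<^sub>1 \<box> G\<^sub>2)
           \<le> min (k_independence_number k G\<^sub>1 * card (pverts G\<^sub>2))
                 (k_independence_number k G\<^sub>2 * card (pverts G\<^sub>1))"
proof (intro conjI min.boundedI)
  note prod = pair_graph_cartesian_product[OF assms(2,3)]
  interpret G1: pair_graph G\<^sub>1 by fact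
  interpret G2: pair_graph G\<^sub>2 by fact
  obtain S where S: "k_independent k G\<^sub>1 S" "card S = k_independence_number k G\<^sub>1"
    using k_independence_number_attained[OF assms(2)] .
  obtain T where T: "k_independent k G\<^sub>2 T" "card T = k_independence_number k G\<^sub>2"
    using k_independence_number_attained[OF assms(3)] .
  show "k_independence_number k G\<^sub>1 * k_independence_number k G\<^sub>2
      \<le> k_independence_number k (G\<^sub>1 \<box> G\<^sub>2)"
    using card_le_k_independence_number[OF prod k_independent_Times[OF assms(2,3) S(1) T(1)]] S(2) T(2)
    by (simp add: card_cartesian_product)
  \<comment> \<open>The product is covered by the copies of \<open>G\<^sub>1\<close>, one for each
    vertex of \<open>G\<^sub>2\<close>. The other bound exchanges the roles of the factors.\<close>
  show "k_independence_number k (G\<^sub>1 \<box> G\<^sub>2) \<le> k_independence_number k G\<^sub>1 * card (pverts G\<^sub>2)"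
    by (rule k_independence_number_le_mult_card_cover
        [OF assms(2) prod G2.pair_finite_verts weak_hom_fibres(1)[OF assms(2,3)]])
      (auto simp: cartesian_product_def)
  show "k_independence_number k (G\<^sub>1 \<box> G\<^sub>2) \<le> k_independence_number k G\<^sub>2 * card (pverts G\<^sub>1)"
    by (rule k_independence_number_le_mult_card_cover
        [OF assms(3) prod G1.pair_finite_verts weak_hom_fibres(2)[OF assms(2,3)]])
      (auto simp: cartesian_product_def)
qed

end
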